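(* Let $G$ be an instance of the Fully Online Matching Problem which admits a matching of size $n$. Then for any $\alpha>0$, \[ \mathbb{P}\left[|M| < (\rho-\alpha)n\right] < e^{-\alpha^2 n}, \] where $M$ is the random variable denoting the matching generated by \textsc{Fully Online Ranking} and $\rho$ is the competitive ratio of \textsc{Fully Online Ranking}.
   Context: Fully Online Matching Problem: $G=(V,E)$ is an undirected (not necessarily bipartite) graph whose vertices arrive and depart online in an adversarial order. When a vertex arrives, all its edges to vertices that have already arrived are revealed; it is guaranteed that by the time a vertex departs, all of its neighbors have arrived (so its entire neighborhood has been revealed). Matching decisions are irrevocable. \textsc{Fully Online Ranking}: when a vertex $i$ arrives, sample an independent uniformly random $x_i\in[0,1]$; when a vertex $i$ departs and is still unmatched, match $i$ to the unmatched neighbor $j\in N(i)$ minimizing $x_j$ (if one exists; ties occur with probability zero). The competitive ratio $\rho$ of \textsc{Fully Online Ranking} is the infimum, over all instances and arrival/departure orders, of the ratio of the expected size of the matching it produces to the size of a maximum matching of the instance. *)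

theory Defs
  imports "HOL-Probability.Probability"
begin

definition simple_graph :: "'v set \<Rightarrow> ('v \<Rightarrow> 'v \<Rightarrow> bool) \<Rightarrow> bool" where
  "simple_graph V E \<longleftrightarrow> finite V \<and> (\<forall>u v. E u v \<longrightarrow> E v u) \<and> (\<forall>v. \<not> E v v)
     \<and> (\<forall>u v. E u v \<longrightarrow> u \<in> V \<and> v \<in> V)"

definition is_matching :: "('v \<Rightarrow> 'v \<Rightarrow> bool) \<Rightarrow> 'v set set \<Rightarrow> bool" where
  "is_matching E M \<longleftrightarrow> (\<forall>e\<in>M. \<exists>u v. e = {u, v} \<and> E u v)
     \<and> (\<forall>e\<in>M. \<forall>f\<in>M. e \<noteq> f \<longrightarrow> e \<inter> f = {})"

definition max_matching_size :: "('v \<Rightarrow> 'v \<Rightarrow> bool) \<Rightarrow> nat" where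
  "max_matching_size E = Max {card M | M. is_matching E M}"

datatype 'v event = Arr 'v | Dep 'v

definition valid_order :: "'v set \<Rightarrow> ('v \<Rightarrow> 'v \<Rightarrow> bool) \<Rightarrow> 'v event list \<Rightarrow> bool" where
  "valid_order V E \<sigma> \<longleftrightarrow> distinct \<sigma> \<and> set \<sigma> = Arr ` V \<union> Dep ` V
     \<and> (\<forall>v\<in>V. \<exists>i<length \<sigma>. \<exists>j<length \<sigma>. i < j \<and> \<sigma> ! i = Arr v \<and> \<sigma> ! j = Dep v)
     \<and> (\<forall>u v. E u v \<longrightarrow> (\<exists>i<length \<sigma>. \<exists>j<length \<sigma>. i < j \<and> \<sigma> ! i = Arr u \<and> \<sigma> ! j = Dep v))"

text \<open>State: (set of arrived vertices, current matching). On departure of an unmatched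
  vertex i, match it to its unmatched (arrived) neighbour of minimal rank x, if any.
  Ties (a probability-zero event) are broken arbitrarily via arg_min_on.\<close>
fun ranking_step :: "('v \<Rightarrow> 'v \<Rightarrow> bool) \<Rightarrow> ('v \<Rightarrow> real) \<Rightarrow> 'v set \<times> 'v set set
    \<Rightarrow> 'v event \<Rightarrow> 'v set \<times> 'v set set" where
  "ranking_step E x (A, M) (Arr v) = (insert v A, M)"
| "ranking_step E x (A, M) (Dep i) =
     (if i \<in> \<Union>M then (A, M)
      else (let C = {j \<in> A. E i j \<and> j \<notin> \<Union>M} in
            if C = {} then (A, M) else (A, insert {i, arg_min_on x C} M)))"

definition ranking_matching :: "('v \<Rightarrow> 'v \<Rightarrow> bool) \<Rightarrow> 'v event list \<Rightarrow> ('v \<Rightarrow> real) \<Rightarrow> 'v set set" where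
  "ranking_matching E \<sigma> x = snd (foldl (ranking_step E x) ({}, {}) \<sigma>)"

definition rank_space :: "'v set \<Rightarrow> ('v \<Rightarrow> real) measure" where
  "rank_space V = PiM V (\<lambda>_. uniform_measure lborel {0..1})"

definition expected_ranking_size :: "'v set \<Rightarrow> ('v \<Rightarrow> 'v \<Rightarrow> bool) \<Rightarrow> 'v event list \<Rightarrow> real" where
  "expected_ranking_size V E \<sigma> =
     (\<integral>x. real (card (ranking_matching E \<sigma> x)) \<partial>rank_space V)"

text \<open>Competitive ratio: infimum over all instances (up to isomorphism every finite graph
  has vertices in nat) with nonzero maximum matching.\<close>
definition ranking_ratio :: real where
  "ranking_ratio = Inf {expected_ranking_size V E \<sigma> / real (max_matching_size E) | V E \<sigma>.
      simple_graph (V :: nat set) E \<and> valid_order V E \<sigma> \<and> max_matching_size E > 0}"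

end

theory Submission
  imports Defs
begin

text \<open>
  Let W be the vertex set of a matching of size n. Inserting one vertex into the graph changes the
  run of Ranking along an alternating path, so the size of the output either stays the same or
  grows by one. Hence the output on G is at least as large as the output on G[W], and the latter
  depends only on the at most 2n ranks of vertices in W, with bounded differences 1. Its
  expectation is at least the competitive ratio times n, and McDiarmid's inequality gives the
  bound; strictness comes from the output size being an integer.
\<close>

section \<open>Removing a vertex from a run\<close>

text \<open>Bounded differences over all ranks would put \<open>card V\<close> into the exponent,
  and \<open>card V\<close> may far exceed n. Restricting to G[W] caps the relevant ranks at 2n, and
  then McDiarmid's exponent 2 t^2 / (2n) at t = \<alpha> n is exactly \<alpha>^2 n. Changing the
  rank of a vertex costs at most one pair because both runs can be compared with the run from which
  that vertex is removed, and this run never reads the rank. So a single statement about removing a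
  vertex yields both the monotonicity in the vertex set and the bounded differences. Two runs that
  differ by a vertex may disagree in many edges along the path, but their sets of unmatched vertices
  differ in at most one element. This is why the state below forgets the edges and keeps only a
  count. A further obstacle is that \<open>ranking_ratio\<close> ranges over graphs with vertices in
  \<open>nat\<close>, whereas the vertex type here is arbitrary. The instance has to be relabelled,
  and this is compatible with \<open>arg_min_on\<close> only off the null set of ties.\<close>

text \<open>
  The run on the subgraph induced by W, tracking only the set of arrived unmatched vertices and
  the number of matched pairs. Vertices outside W never arrive.
\<close>

fun avail_step :: "('v \<Rightarrow> 'v \<Rightarrow> bool) \<Rightarrow> ('v set \<Rightarrow> 'v) \<Rightarrow> 'v set \<Rightarrow> 'v set \<times> nat \<Rightarrow> 'v event \<Rightarrow> 'v set \<times> nat"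
  where
    "avail_step E c W (U, k) (Arr v) = (if v \<in> W then (insert v U, k) else (U, k))"
  | "avail_step E c W (U, k) (Dep i) =
      (let C = {j \<in> U. E i j} in
       if i \<in> U \<and> C \<noteq> {} then (U - {i, c C}, Suc k) else (U, k))"

definition avail_run where
  "avail_run E c W \<sigma> = foldl (avail_step E c W) ({}, 0) \<sigma>"

text \<open>Selection by a fixed linear order, stripped of ranks: the choice is a candidate, and an
  additional candidate either wins or leaves the winner unchanged. The path argument uses no other
  information about the selection rule.\<close>

definition consistent_choice :: "'v set \<Rightarrow> ('v set \<Rightarrow> 'v) \<Rightarrow> bool" where
  "consistent_choice V c \<longleftrightarrow> (\<forall>C\<subseteq>V. C \<noteq> {} \<longrightarrow> c C \<in> C)
     \<and> (\<forall>C\<subseteq>V. \<forall>w\<in>V. c (insert w C) = w \<or> C \<noteq> {} \<and> c (insert w C) = c C)"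

text \<open>
  The alternating path argument: the two runs differ in at most one available vertex, the
  current end point of the path. The third case has the extra vertex in the smaller graph,
  which has then matched one pair less.
\<close>

definition off_by_one :: "'v set \<times> nat \<Rightarrow> 'v set \<times> nat \<Rightarrow> bool" where
  "off_by_one s s' \<longleftrightarrow>
     (fst s = fst s' \<and> (snd s = snd s' \<or> snd s = Suc (snd s')))
     \<or> (\<exists>w. w \<notin> fst s' \<and> fst s = insert w (fst s') \<and> snd s = snd s')
     \<or> (\<exists>w. w \<notin> fst s \<and> fst s' = insert w (fst s) \<and> snd s = Suc (snd s'))"

text \<open>A departure moves the path end by at most one step. If \<open>w\<close> departs, only
  the first run can match it, and its partner becomes the extra vertex of the second run. If
  \<open>i\<close> departs and the first run gives it \<open>w\<close>, the second run falls back on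
  \<open>c C\<close>, which is now extra in the first run; without a fallback, \<open>i\<close>
  stays unmatched in the second run and is the extra vertex there.\<close>

lemma off_by_one_insert_step:
  assumes c: "consistent_choice V c" and E: "\<forall>u v. E u v \<longrightarrow> v \<in> V \<and> u \<noteq> v"
    and w: "w \<notin> U"
  shows "(let (U1, k1) = avail_step E c W (insert w U, k) (Dep i); (U2, k2) = avail_step E c W (U, k) (Dep i)
     in (\<exists>w. w \<notin> U2 \<and> U1 = insert w U2 \<and> k1 = k2) \<or>
        (\<exists>w. w \<notin> U1 \<and> U2 = insert w U1 \<and> k1 = Suc k2) \<or> (U1 = U2 \<and> k1 = Suc k2))"
proof -
  define C where "C = {j \<in> U. E i j}"
  define D where "D = {j \<in> insert w U. E i j}"
  have CV: "C \<subseteq> V" "D \<subseteq> V" using E by (auto simp: C_def D_def)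
  have cC: "c C \<in> C" if "C \<noteq> {}" using c CV that unfolding consistent_choice_def by blast
  have cD: "c D \<in> D" if "D \<noteq> {}" using c CV that unfolding consistent_choice_def by blast
  have stepU: "avail_step E c W (U, k) (Dep i) = (if i \<in> U \<and> C \<noteq> {} then (U - {i, c C}, Suc k) else (U, k))"
    by (simp add: C_def Let_def)
  have stepI: "avail_step E c W (insert w U, k) (Dep i) =
     (if i \<in> insert w U \<and> D \<noteq> {} then (insert w U - {i, c D}, Suc k) else (insert w U, k))"
    by (simp add: D_def Let_def)
  have Ci: "i \<notin> C" "i \<notin> D" using E unfolding C_def D_def by blast+
  have CU: "C \<subseteq> U" "D \<subseteq> insert w U" by (auto simp: C_def D_def)
  consider "i \<notin> insert w U" | "i = w" | "i \<in> U" "\<not> E i w" | "i \<in> U" "E i w" by blast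
  then show ?thesis
  proof cases
    case 1
    with w show ?thesis unfolding stepU stepI by auto
  next
    case 2
    then have "D = C" using E by (auto simp: C_def D_def)
    show ?thesis
    proof (cases "C = {}")
      case True
      then show ?thesis unfolding stepU stepI using 2 w \<open>D = C\<close> by (auto simp: Let_def)
    next
      case False
      then have "c C \<in> U" "c C \<noteq> i" using cC CU Ci by auto
      then have "U = insert (c C) (insert w U - {i, c C})" "c C \<notin> insert w U - {i, c C}"
        using 2 w by auto
      then show ?thesis unfolding stepU stepI using 2 w \<open>D = C\<close> False by (simp add: Let_def) blast
    qed
  next
    case 3
    then have "D = C" by (auto simp: C_def D_def)
    then show ?thesis
      unfolding stepU stepI using 3 w cC CU Ci
      by (auto simp: Let_def intro!: exI[of _ "w"])
  next
    case 4
    then have D: "D = insert w C" by (auto simp: C_def D_def)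
    have "w \<in> V" using 4 E by blast
    then have ch: "c D = w \<or> C \<noteq> {} \<and> c D = c C" using c CV unfolding consistent_choice_def D by blast
    show ?thesis
    proof (cases "C = {}")
      case True
      then have "c D = w" using ch by blast
      then show ?thesis unfolding stepU stepI using 4 w True D by (auto simp: Let_def)
    next
      case False
      have cU: "c C \<in> U" "c C \<noteq> i" using cC[OF False] CU Ci by auto
      show ?thesis
      proof (cases "c D = w")
        case True
        have "insert w U - {i, w} = insert (c C) (U - {i, c C})"
          using w cU by auto
        then show ?thesis unfolding stepU stepI using 4 w D True False cU by (auto simp: Let_def)
      next
        case False2: False
        then have "c D = c C" using ch by blast
        moreover have "insert w U - {i, c C} = insert w (U - {i, c C})"
          using w cU 4 by auto
        ultimately show ?thesis unfolding stepU stepI using 4 w D False cU by (auto simp: Let_def)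
      qed
    qed
  qed
qed

text \<open>The counter is written but never read. States whose counters differ by one can therefore
  be reduced to states with equal counters.\<close>

lemma avail_step_snd_shift:
  "avail_step E c W (U, k + m) e = (fst (avail_step E c W (U, k) e), snd (avail_step E c W (U, k) e) + m)"
  by (cases e) (auto simp: Let_def)

lemma off_by_one_step:
  assumes c: "consistent_choice V c" and E: "\<forall>u v. E u v \<longrightarrow> v \<in> V \<and> u \<noteq> v"
    and s: "off_by_one s s'"
  shows "off_by_one (avail_step E c W s e) (avail_step E c W s' e)"
proof -
  obtain U k U' k' where ss: "s = (U, k)" "s' = (U', k')" by fastforce
  from s consider (eq) "U = U'" "k = k' \<or> k = Suc k'"
    | (more) w where "w \<notin> U'" "U = insert w U'" "k = k'"
    | (less) w where "w \<notin> U" "U' = insert w U" "k = Suc k'"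
    unfolding off_by_one_def ss by auto
  then show ?thesis
  proof cases
    case eq
    obtain U1 k1 where "avail_step E c W (U', k') e = (U1, k1)" by fastforce
    with avail_step_snd_shift[of E c W U' k' 1 e]
    have "avail_step E c W s' e = (U1, k1)" "avail_step E c W (U', Suc k') e = (U1, Suc k1)"
      by (simp_all add: ss)
    then have "avail_step E c W s e = (U1, k1) \<or> avail_step E c W s e = (U1, Suc k1)"
      using eq ss by metis
    moreover have "off_by_one (U1, k1) (U1, k1)" "off_by_one (U1, Suc k1) (U1, k1)"
      by (simp_all add: off_by_one_def)
    ultimately show ?thesis
      using \<open>avail_step E c W s' e = (U1, k1)\<close> by metis
  next
    case more
    show ?thesis
    proof (cases e)
      case (Arr v)
      show ?thesis
      proof (cases "v \<in> W \<and> v \<noteq> w")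
        case True
        then have "avail_step E c W s e = (insert w (insert v U'), k')"
          "avail_step E c W s' e = (insert v U', k')" "w \<notin> insert v U'"
          using more Arr ss by auto
        then show ?thesis unfolding off_by_one_def by auto
      next
        case False
        then have "avail_step E c W s e = (insert w U', k')"
          "avail_step E c W s' e = (insert w U', k') \<or> avail_step E c W s' e = (U', k')"
          using more Arr ss by auto
        then show ?thesis unfolding off_by_one_def using more by auto
      qed
    next
      case (Dep i)
      show ?thesis
        using off_by_one_insert_step[of V c E w U' W k' i, OF c E more(1)]
        unfolding ss more Dep off_by_one_def Let_def case_prod_beta by metis
    qed
  next
    case less
    have shift: "avail_step E c W (U, Suc k') e =
        (fst (avail_step E c W (U, k') e), Suc (snd (avail_step E c W (U, k') e)))" for e
      using avail_step_snd_shift[of E c W U k' 1 e] by simp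
    show ?thesis
    proof (cases e)
      case (Arr v)
      show ?thesis
      proof (cases "v \<in> W \<and> v \<noteq> w")
        case True
        then have "avail_step E c W s e = (insert v U, Suc k')"
          "avail_step E c W s' e = (insert w (insert v U), k')" "w \<notin> insert v U"
          using less Arr ss by auto
        then show ?thesis unfolding off_by_one_def by auto
      next
        case False
        then have "avail_step E c W s' e = (insert w U, k')"
          "avail_step E c W s e = (insert w U, Suc k') \<or> avail_step E c W s e = (U, Suc k')"
          using less Arr ss by auto
        then show ?thesis unfolding off_by_one_def using less by auto
      qed
    next
      case (Dep i)
      define t t' where "t = avail_step E c W (insert w U, k') (Dep i)"
        and "t' = avail_step E c W (U, k') (Dep i)"
      have "(\<exists>w. w \<notin> fst t' \<and> fst t = insert w (fst t') \<and> snd t = snd t') \<or>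
          (\<exists>w. w \<notin> fst t \<and> fst t' = insert w (fst t) \<and> snd t = Suc (snd t')) \<or>
          fst t = fst t' \<and> snd t = Suc (snd t')"
        using off_by_one_insert_step[of V c E w U W k' i, OF c E less(1)]
        unfolding t_def t'_def Let_def case_prod_beta .
      \<comment> \<open>Here the roles are exchanged: the run on the smaller graph holds the extra
        vertex, and the other run is one pair ahead. Raising the counter of \<open>t'\<close> sends
        the three outcomes, in order, to the third, second and first case of
        \<open>off_by_one\<close>.\<close>
      then have "off_by_one (fst t', Suc (snd t')) t"
        unfolding off_by_one_def fst_conv snd_conv by metis
      moreover have "avail_step E c W s e = (fst t', Suc (snd t'))" "avail_step E c W s' e = t"
        unfolding ss less Dep t_def t'_def using shift by auto
      ultimately show ?thesis by metis
    qed
  qed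
qed

lemma avail_step_insert_eq:
  "e \<noteq> Arr v \<Longrightarrow> avail_step E c (insert v W) s e = avail_step E c W s e"
  by (cases s; cases e) auto

lemma foldl_avail_step_insert_eq:
  "Arr v \<notin> set \<sigma> \<Longrightarrow> foldl (avail_step E c (insert v W)) s \<sigma> = foldl (avail_step E c W) s \<sigma>"
  by (induction \<sigma> arbitrary: s) (auto simp: avail_step_insert_eq)

lemma off_by_one_foldl:
  assumes c: "consistent_choice V c" and E: "\<forall>u v. E u v \<longrightarrow> v \<in> V \<and> u \<noteq> v"
    and s: "off_by_one s s'"
  shows "off_by_one (foldl (avail_step E c W) s \<sigma>) (foldl (avail_step E c W) s' \<sigma>)"
  using s
proof (induction \<sigma> arbitrary: s s')
  case (Cons e \<sigma>)
  show ?case using Cons.IH[OF off_by_one_step[OF c E Cons.prems]] by simp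
qed simp

text \<open>The runs agree up to the arrival of \<open>v\<close>, which creates the only
  discrepancy. As \<open>v\<close> arrives just once, both remaining runs can be taken with the same
  \<open>W\<close>, and the invariant carries the discrepancy to the end.\<close>

lemma avail_run_insert:
  assumes c: "consistent_choice V c" and E: "\<forall>u v. E u v \<longrightarrow> v \<in> V \<and> u \<noteq> v"
    and "distinct \<sigma>"
  shows "off_by_one (avail_run E c (insert v W) \<sigma>) (avail_run E c W \<sigma>)"
proof (cases "Arr v \<in> set \<sigma>")
  case False
  then show ?thesis
    unfolding avail_run_def foldl_avail_step_insert_eq[OF False] by (simp add: off_by_one_def)
next
  case True
  then obtain p q where \<sigma>: "\<sigma> = p @ Arr v # q" by (meson split_list)
  have pq: "Arr v \<notin> set p" "Arr v \<notin> set q" using \<open>distinct \<sigma>\<close> \<sigma> by auto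
  define s where "s = foldl (avail_step E c W) ({}, 0) p"
  have "off_by_one (avail_step E c (insert v W) s (Arr v)) (avail_step E c W s (Arr v))"
    by (cases s) (auto simp: off_by_one_def)
  then show ?thesis
    unfolding avail_run_def \<sigma>
    by (auto simp: foldl_avail_step_insert_eq[OF pq(1)] foldl_avail_step_insert_eq[OF pq(2)] s_def[symmetric]
        intro!: off_by_one_foldl[OF c E])
qed

text \<open>The lower bound yields monotonicity in the vertex set, the upper bound the bounded
  differences.\<close>

lemma avail_run_insert_bounds:
  assumes c: "consistent_choice V c" and E: "\<forall>u v. E u v \<longrightarrow> v \<in> V \<and> u \<noteq> v"
    and "distinct \<sigma>"
  shows "snd (avail_run E c W \<sigma>) \<le> snd (avail_run E c (insert v W) \<sigma>)"
    "snd (avail_run E c (insert v W) \<sigma>) \<le> Suc (snd (avail_run E c W \<sigma>))"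
  using avail_run_insert[where E = E and W = W and v = v, OF c E assms(3)] unfolding off_by_one_def by auto

lemma avail_run_mono:
  assumes c: "consistent_choice V c" and E: "\<forall>u v. E u v \<longrightarrow> v \<in> V \<and> u \<noteq> v"
    and "distinct \<sigma>" and "W \<subseteq> W'" "finite W'"
  shows "snd (avail_run E c W \<sigma>) \<le> snd (avail_run E c W' \<sigma>)"
proof -
  have "snd (avail_run E c W \<sigma>) \<le> snd (avail_run E c (W \<union> D) \<sigma>)" if "finite D" for D
    using that
  proof induction
    case (insert x F)
    then show ?case using avail_run_insert_bounds(1)[where E = E and W = "W \<union> F" and v = x, OF c E assms(3)] by simp
  qed simp
  from this[of W'] assms show ?thesis by (simp add: Un_absorb1)
qed

text \<open>Candidates always come from \<open>W\<close>, so ranks outside \<open>W\<close> have no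
  influence. Applied to \<open>W - {i}\<close>, this makes the run independent of the rank of
  \<open>i\<close>.\<close>

lemma avail_run_cong:
  assumes "\<And>C. C \<subseteq> W \<Longrightarrow> c C = c' C"
  shows "avail_run E c W \<sigma> = avail_run E c' W \<sigma>"
proof -
  have "avail_run E c W \<sigma> = avail_run E c' W \<sigma> \<and> fst (avail_run E c W \<sigma>) \<subseteq> W"
  proof (induction \<sigma> rule: rev_induct)
    case Nil
    then show ?case by (simp add: avail_run_def)
  next
    case (snoc e \<sigma>)
    obtain U k where U: "avail_run E c W \<sigma> = (U, k)" by fastforce
    with snoc have "avail_run E c' W \<sigma> = (U, k)" "U \<subseteq> W" by auto
    moreover have "c {j \<in> U. E i j} = c' {j \<in> U. E i j}" for i
      using \<open>U \<subseteq> W\<close> by (intro assms) auto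
    ultimately show ?case using U
      by (cases e) (auto simp: avail_run_def Let_def)
  qed
  then show ?thesis by blast
qed

section \<open>The abstract run computes the size of the matching\<close>

lemma ranking_step_Dep:
  "ranking_step E x (A, M) (Dep i) =
     (if i \<in> \<Union>M \<or> {j \<in> A. E i j \<and> j \<notin> \<Union>M} = {} then (A, M)
      else (A, insert {i, arg_min_on x {j \<in> A. E i j \<and> j \<notin> \<Union>M}} M))"
  by (simp only: ranking_step.simps Let_def split: if_split) blast

text \<open>A part of the validity of an order that is inherited by prefixes, as induction from the
  right requires.\<close>

definition well_ordered_events :: "'v event list \<Rightarrow> bool" where
  "well_ordered_events \<sigma> \<longleftrightarrow> distinct \<sigma> \<and> (\<forall>p i s. \<sigma> = p @ Dep i # s \<longrightarrow> Arr i \<in> set p)"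

lemma valid_order_imp_well_ordered_events:
  assumes "valid_order V E \<sigma>"
  shows "well_ordered_events \<sigma>"
  unfolding well_ordered_events_def
proof (intro conjI allI impI)
  show d: "distinct \<sigma>" using assms by (simp add: valid_order_def)
  fix p i s assume \<sigma>: "\<sigma> = p @ Dep i # s"
  then have "i \<in> V" using assms by (auto simp: valid_order_def)
  then obtain m n where mn: "m < n" "n < length \<sigma>" "\<sigma> ! m = Arr i" "\<sigma> ! n = Dep i"
    using assms unfolding valid_order_def by blast
  have "\<sigma> ! length p = Dep i" "length p < length \<sigma>" using \<sigma> by auto
  then have "n = length p" using mn d by (metis nth_eq_iff_index_eq)
  then have "m < length p" "p ! m = Arr i" using mn \<sigma> by (auto simp: nth_append)
  then show "Arr i \<in> set p" by (metis nth_mem)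
qed

text \<open>Vertices outside \<open>W\<close> still arrive and depart in the concrete run, but they
  are isolated in \<open>EW\<close>. The invariant therefore identifies \<open>U\<close> with the
  arrived unmatched vertices only after intersecting with \<open>W\<close>. A vertex that departs
  unmatched stays in both states.\<close>

lemma avail_run_simulates_ranking:
  fixes W :: "'v set"
  assumes ord: "well_ordered_events \<sigma>"
    and W: "finite W"
    and EW: "\<And>u v. EW u v \<longleftrightarrow> E u v \<and> u \<in> W \<and> v \<in> W"
    and irrefl: "\<And>v. \<not> E v v"
    and c: "\<And>C. C \<subseteq> W \<Longrightarrow> C \<noteq> {} \<Longrightarrow> arg_min_on x C = c C"
  shows "card (ranking_matching EW \<sigma> x) = snd (avail_run E c W \<sigma>)"
proof -
  have "let (A, M) = foldl (ranking_step EW x) ({}, {}) \<sigma>; (U, k) = avail_run E c W \<sigma> in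
      A = {v. Arr v \<in> set \<sigma>} \<and> U = (A - \<Union>M) \<inter> W \<and> k = card M \<and> \<Union>M \<subseteq> A \<inter> W \<and> finite M"
    using ord
  proof (induction \<sigma> rule: rev_induct)
    case Nil
    then show ?case by (simp add: avail_run_def)
  next
    case (snoc e \<sigma>)
    obtain A M where AM: "foldl (ranking_step EW x) ({}, {}) \<sigma> = (A, M)" by fastforce
    obtain U k where Uk: "avail_run E c W \<sigma> = (U, k)" by fastforce
    have wo: "well_ordered_events \<sigma>"
      using snoc.prems unfolding well_ordered_events_def by auto
    have IH: "A = {v. Arr v \<in> set \<sigma>}" "U = (A - \<Union>M) \<inter> W" "k = card M" "\<Union>M \<subseteq> A \<inter> W" "finite M"
      using snoc.IH[OF wo] AM Uk by auto
    show ?case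
    proof (cases e)
      case (Arr v)
      then have "v \<notin> A" using snoc.prems IH by (auto simp: well_ordered_events_def)
      then show ?thesis using AM Uk IH Arr by (auto simp: avail_run_def)
    next
      case (Dep i)
      \<comment> \<open>\<open>avail_step\<close> tests whether the departing vertex is available,
        whereas \<open>ranking_step\<close> tests only that it is unmatched. That it has arrived
        must come from the order of events.\<close>
      have "i \<in> A" using snoc.prems unfolding IH Dep well_ordered_events_def by blast
      define C where "C = {j \<in> U. E i j}"
      define D where "D = {j \<in> A. EW i j \<and> j \<notin> \<Union>M}"
      have step1: "avail_run E c W (\<sigma> @ [e]) = (if i \<in> U \<and> C \<noteq> {} then (U - {i, c C}, Suc k) else (U, k))"
        using Uk by (simp add: avail_run_def Dep C_def Let_def)
      have step2: "foldl (ranking_step EW x) ({}, {}) (\<sigma> @ [e]) =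
          (if i \<in> \<Union>M \<or> D = {} then (A, M) else (A, insert {i, arg_min_on x D} M))"
        by (simp only: foldl_append AM Dep D_def foldl.simps ranking_step_Dep)
      show ?thesis
      proof (cases "i \<in> U \<and> C \<noteq> {}")
        case False
        then have "i \<in> \<Union>M \<or> D = {}"
          using IH \<open>i \<in> A\<close> EW unfolding C_def D_def by blast
        then have "foldl (ranking_step EW x) ({}, {}) (\<sigma> @ [e]) = (A, M)"
          unfolding step2 by auto
        moreover have "avail_run E c W (\<sigma> @ [e]) = (U, k)" unfolding step1 using False by auto
        ultimately show ?thesis using IH Dep by auto
      next
        case True
        have DC: "D = C" using True IH EW unfolding C_def D_def by blast
        have i: "i \<notin> \<Union>M" "i \<in> W" using True IH by auto
        have CW: "C \<subseteq> W" "finite C" using IH W by (auto simp: C_def intro: finite_subset)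
        have cc: "arg_min_on x C = c C" using c CW True by blast
        have cin: "c C \<in> C" unfolding cc[symmetric]
          using True CW by (intro arg_min_if_finite(1)) auto
        then have cin: "c C \<in> U" "c C \<noteq> i" using irrefl by (auto simp: C_def)
        have "{i, c C} \<notin> M" using i by blast
        then show ?thesis unfolding step1 step2 
          using DC i True IH Dep cc cin \<open>i \<in> A\<close> by auto
      qed
    qed
  qed
  then show ?thesis
    unfolding ranking_matching_def by (auto simp: Let_def split: prod.splits)
qed

section \<open>Tie breaking\<close>

text \<open>
  \<^const>\<open>arg_min_on\<close> may break ties differently for different candidate sets, which destroys the
  alternating path structure. Breaking ties by a fixed injection h is consistent for every rank
  vector and agrees with \<^const>\<open>arg_min_on\<close> almost surely.
\<close>

definition lex_choice :: "('v \<Rightarrow> nat) \<Rightarrow> ('v \<Rightarrow> real) \<Rightarrow> 'v set \<Rightarrow> 'v" where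
  "lex_choice h x C = (THE u. u \<in> C \<and> (\<forall>v\<in>C. v \<noteq> u \<longrightarrow> x u < x v \<or> x u = x v \<and> h u < h v))"

lemma lex_choice_unique:
  assumes "u \<in> C" "\<And>v. v \<in> C \<Longrightarrow> v \<noteq> u \<Longrightarrow> x u < x v \<or> x u = x v \<and> h u < h v"
  shows "lex_choice h x C = u"
  unfolding lex_choice_def
proof (rule the_equality)
  fix w assume w: "w \<in> C \<and> (\<forall>v\<in>C. v \<noteq> w \<longrightarrow> x w < x v \<or> x w = x v \<and> h w < h v)"
  show "w = u" 
  proof (rule ccontr)
    assume "w \<noteq> u"
    with w assms(1) assms(2)[of w] show False by force
  qed
qed (use assms in blast)

lemma lex_choice_least:
  assumes "finite C" "C \<noteq> {}" "inj_on h C"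
  shows "lex_choice h x C \<in> C"
    "v \<in> C \<Longrightarrow> v \<noteq> lex_choice h x C \<Longrightarrow>
       x (lex_choice h x C) < x v \<or> x (lex_choice h x C) = x v \<and> h (lex_choice h x C) < h v"
proof -
  have "\<exists>u\<in>C. \<forall>v\<in>C. v \<noteq> u \<longrightarrow> x u < x v \<or> x u = x v \<and> h u < h v"
    using assms
  proof (induction C rule: finite_ne_induct)
    case (insert w C)
    then obtain u where u: "u \<in> C" "\<forall>v\<in>C. v \<noteq> u \<longrightarrow> x u < x v \<or> x u = x v \<and> h u < h v" by auto
    have "h w \<noteq> h u" using insert u by (auto simp: inj_on_def)
    then consider "x u < x w \<or> x u = x w \<and> h u < h w" | "x w < x u \<or> x w = x u \<and> h w < h u"
      by force
    then show ?case
    proof cases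
      case 1
      then show ?thesis using u by (intro bexI[of _ u]) auto
    next
      case 2
      then have "x w < x v \<or> x w = x v \<and> h w < h v" if "v \<in> C" for v
        using u that by (cases "v = u") force+
      then show ?thesis by (intro bexI[of _ w]) auto
    qed
  qed auto
  then obtain u where u: "u \<in> C" "\<forall>v\<in>C. v \<noteq> u \<longrightarrow> x u < x v \<or> x u = x v \<and> h u < h v" by blast
  then have "lex_choice h x C = u" by (intro lex_choice_unique) auto
  with u show "lex_choice h x C \<in> C"
    "v \<in> C \<Longrightarrow> v \<noteq> lex_choice h x C \<Longrightarrow>
       x (lex_choice h x C) < x v \<or> x (lex_choice h x C) = x v \<and> h (lex_choice h x C) < h v"
    by auto
qed

text \<open>A least element of \<open>insert w C\<close> other than \<open>w\<close> lies in
  \<open>C\<close> and is least there as well; this holds with or without ties among the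
  ranks.\<close>

lemma consistent_choice_lex_choice:
  assumes "finite V" "inj_on h V"
  shows "consistent_choice V (lex_choice h x)"
  unfolding consistent_choice_def
proof (intro conjI allI impI ballI)
  fix C assume "C \<subseteq> V" "C \<noteq> {}"
  then show "lex_choice h x C \<in> C"
    using assms by (intro lex_choice_least) (auto intro: finite_subset inj_on_subset)
next
  fix C w assume C: "C \<subseteq> V" and w: "w \<in> V"
  let ?u = "lex_choice h x (insert w C)"
  have *: "finite (insert w C)" "insert w C \<noteq> {}" "inj_on h (insert w C)"
    using assms(1) C w inj_on_subset[OF assms(2), of "insert w C"]
    by (auto intro: finite_subset simp del: inj_on_insert)
  note l = lex_choice_least[where x = x, OF *]
  show "?u = w \<or> C \<noteq> {} \<and> ?u = lex_choice h x C"
  proof (cases "?u = w")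
    case False
    then have "?u \<in> C" using l(1) by auto
    moreover from this have "lex_choice h x C = ?u" using l(2) by (intro lex_choice_unique) auto
    ultimately show ?thesis by auto
  qed simp
qed

text \<open>Injective ranks leave no tie to break, so \<open>h\<close> is arbitrary here; the
  relabelling argument later uses a constant \<open>h\<close>.\<close>

lemma arg_min_on_eq_lex_choice:
  assumes "finite C" "C \<noteq> {}" "inj_on x C"
  shows "arg_min_on x C = lex_choice h x C"
proof (rule lex_choice_unique[symmetric])
  show in_C: "arg_min_on x C \<in> C" using assms by (intro arg_min_if_finite)
  fix v assume "v \<in> C" "v \<noteq> arg_min_on x C"
  then show "x (arg_min_on x C) < x v \<or> x (arg_min_on x C) = x v \<and> h (arg_min_on x C) < h v"
    using arg_min_least[OF assms(1,2), of v x] in_C assms(3) by (force simp: inj_on_def)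
qed

text \<open>\<open>arg_min_on\<close> is a Hilbert choice from the minimality predicate, and equal
  predicates give equal choices even under ties. So the output depends only on the order pattern of
  the ranks, which is the source of its measurability.\<close>

lemma arg_min_on_order_cong:
  fixes x y :: "'v \<Rightarrow> real"
  assumes "\<And>u v. u \<in> C \<Longrightarrow> v \<in> C \<Longrightarrow> x u < x v \<longleftrightarrow> y u < y v"
  shows "arg_min_on x C = arg_min_on y C"
proof -
  have "is_arg_min x (\<lambda>u. u \<in> C) = is_arg_min y (\<lambda>u. u \<in> C)"
    using assms by (auto simp: is_arg_min_def fun_eq_iff)
  then show ?thesis unfolding arg_min_on_def arg_min_def by simp
qed

lemma lex_choice_order_cong:
  fixes x y :: "'v \<Rightarrow> real"
  assumes "\<And>u v. u \<in> C \<Longrightarrow> v \<in> C \<Longrightarrow> x u < x v \<longleftrightarrow> y u < y v"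
  shows "lex_choice h x C = lex_choice h y C"
proof -
  have eq: "x u < x v \<or> x u = x v \<and> h u < h v \<longleftrightarrow> y u < y v \<or> y u = y v \<and> h u < h v"
    if "u \<in> C" "v \<in> C" for u v
    using assms[OF that] assms[OF that(2,1)] by (metis linorder_less_linear order_less_irrefl)
  show ?thesis unfolding lex_choice_def
    by (rule arg_cong[of _ _ The], rule ext) (use eq in blast)
qed

lemma ranking_matching_cong:
  assumes E: "\<And>u v. E u v \<Longrightarrow> v \<in> V" and "\<And>C. C \<subseteq> V \<Longrightarrow> arg_min_on x C = arg_min_on y C"
  shows "ranking_matching E \<sigma> x = ranking_matching E \<sigma> y"
proof -
  have "ranking_step E x s e = ranking_step E y s e" for s e
  proof (cases s; cases e)
    fix A M i assume "s = (A, M)" "e = Dep i"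
    moreover have "arg_min_on x {j \<in> A. E i j \<and> j \<notin> \<Union>M} = arg_min_on y {j \<in> A. E i j \<and> j \<notin> \<Union>M}"
      using E by (intro assms(2)) auto
    ultimately show ?thesis by (simp only: ranking_step_Dep)
  qed auto
  then have "ranking_step E x = ranking_step E y" by (intro ext)
  then show ?thesis by (simp add: ranking_matching_def)
qed

lemma ranking_matching_subset:
  assumes E: "\<And>u v. E u v \<Longrightarrow> u \<in> V \<and> v \<in> V" and "finite V"
  shows "ranking_matching E \<sigma> x \<subseteq> Pow V"
proof -
  have "snd (foldl (ranking_step E x) ({}, {}) \<sigma>) \<subseteq> Pow V"
  proof (induction \<sigma> rule: rev_induct)
    case (snoc e \<sigma>)
    obtain A M where AM: "foldl (ranking_step E x) ({}, {}) \<sigma> = (A, M)" by fastforce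
    show ?case
    proof (cases e)
      case (Dep i)
      define C where "C = {j \<in> A. E i j \<and> j \<notin> \<Union>M}"
      have "finite C" using E assms(2) by (auto simp: C_def intro: finite_subset)
      then have "C \<noteq> {} \<Longrightarrow> arg_min_on x C \<in> C" by (intro arg_min_if_finite)
      then have "C \<noteq> {} \<Longrightarrow> {i, arg_min_on x C} \<subseteq> V" using E unfolding C_def by blast
      moreover have "foldl (ranking_step E x) ({}, {}) (\<sigma> @ [e]) =
          (if i \<in> \<Union>M \<or> C = {} then (A, M) else (A, insert {i, arg_min_on x C} M))"
        by (simp only: foldl_append AM Dep C_def foldl.simps ranking_step_Dep)
      ultimately show ?thesis using snoc AM by auto
    qed (use snoc AM in auto)
  qed simp
  then show ?thesis unfolding ranking_matching_def .
qed

section \<open>McDiarmid's inequality\<close>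

text \<open>Hoeffding's lemma for a function of which only the width of the range is known. This
  form fits the sections of a function of several coordinates, whose range moves with the fixed
  coordinates while its width stays bounded.\<close>

lemma (in prob_space) Hoeffding_lemma_oscillation:
  fixes f :: "'a \<Rightarrow> real"
  assumes f: "f \<in> borel_measurable M" and bdd: "\<And>x. x \<in> space M \<Longrightarrow> \<bar>f x\<bar> \<le> B"
    and osc: "\<And>x y. x \<in> space M \<Longrightarrow> y \<in> space M \<Longrightarrow> f x - f y \<le> d" and l: "l > 0"
  shows "(\<integral>\<^sup>+x. ennreal (exp (l * (f x - expectation f))) \<partial>M) \<le> ennreal (exp (l\<^sup>2 * d\<^sup>2 / 8))"
proof -
  define a where "a = Inf (f ` space M)"
  have ne: "f ` space M \<noteq> {}" using not_empty by simp
  have bb: "bdd_below (f ` space M)"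
  proof (rule bdd_belowI2)
    show "- B \<le> f x" if "x \<in> space M" for x using bdd[OF that] by linarith
  qed
  interpret interval_bounded_random_variable M f a "a + d"
  proof
    show "AE x in M. f x \<in> {a..a + d}"
    proof (rule AE_I2)
      fix x assume x: "x \<in> space M"
      have "a \<le> f x" unfolding a_def using x bb by (intro cInf_lower) auto
      moreover have "f x - d \<le> a" unfolding a_def using osc[OF x] ne by (intro cInf_greatest) (auto simp: algebra_simps)
      ultimately show "f x \<in> {a..a + d}" by auto
    qed
  qed (rule f)
  show ?thesis using Hoeffdings_lemma_nn_integral[OF l] by simp
qed

text \<open>Induction on the coordinates takes the place of the Doob martingale: integrating out
  coordinate \<open>i\<close> gives a function \<open>g\<close> of the others that inherits the
  bound and the differences \<open>d j\<close>, while the fluctuation around \<open>g\<close> costs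
  one factor from Hoeffding's lemma.\<close>

lemma (in product_prob_space) bounded_differences_mgf:
  fixes f :: "('i \<Rightarrow> 'a) \<Rightarrow> real"
  assumes "finite I" and f: "f \<in> borel_measurable (PiM I M)"
    and bdd: "\<And>x. x \<in> space (PiM I M) \<Longrightarrow> \<bar>f x\<bar> \<le> B"
    and diff: "\<And>x i y. x \<in> space (PiM I M) \<Longrightarrow> i \<in> I \<Longrightarrow> y \<in> space (M i) \<Longrightarrow> \<bar>f x - f (x(i := y))\<bar> \<le> d i"
    and l: "l > 0"
  shows "(\<integral>\<^sup>+x. ennreal (exp (l * (f x - (\<integral>z. f z \<partial>PiM I M)))) \<partial>PiM I M)
     \<le> ennreal (exp (l\<^sup>2 * (\<Sum>i\<in>I. (d i)\<^sup>2) / 8))"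
  using assms(1) f bdd diff
proof (induction I arbitrary: f rule: finite_induct)
  case empty
  interpret E: prob_space "PiM {} M" by (intro prob_space_PiM prob_space)
  define a where "a = f (\<lambda>_. undefined)"
  have f: "f x = a" if "x \<in> space (PiM {} M)" for x
    using that by (simp add: space_PiM_empty a_def)
  have "(\<integral>z. f z \<partial>PiM {} M) = (\<integral>z. a \<partial>PiM {} M)"
    by (intro Bochner_Integration.integral_cong refl f)
  then have "(\<integral>z. f z \<partial>PiM {} M) = a" using E.prob_space by simp
  then have "(\<integral>\<^sup>+x. ennreal (exp (l * (f x - (\<integral>z. f z \<partial>PiM {} M)))) \<partial>PiM {} M) = (\<integral>\<^sup>+x. 1 \<partial>PiM {} M)"
    by (intro nn_integral_cong) (simp add: f)
  then show ?case using E.emeasure_space_1 by simp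
next
  case (insert i J)
  note fm [measurable] = insert.prems(1)
  have Mi: "prob_space (M i)" by (rule prob_space)
  interpret PJ: prob_space "PiM J M" by (intro prob_space_PiM prob_space)
  interpret PI: prob_space "PiM (insert i J) M" by (intro prob_space_PiM prob_space)
  define g where "g x = (\<integral>y. f (x(i := y)) \<partial>M i)" for x
  have upd: "x(i := y) \<in> space (PiM (insert i J) M)" if "x \<in> space (PiM J M)" "y \<in> space (M i)" for x y
    using that unfolding space_PiM by (intro PiE_fun_upd)
  have [measurable]: "(\<lambda>(x, y). f (x(i := y))) \<in> borel_measurable (PiM J M \<Otimes>\<^sub>M M i)"
    using measurable_compose[OF measurable_add_dim fm] by (simp add: case_prod_beta')
  have fxm: "(\<lambda>y. f (x(i := y))) \<in> borel_measurable (M i)" if "x \<in> space (PiM J M)" for x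
    using measurable_comp[OF measurable_component_update[OF that insert.hyps(2)] fm] by (simp add: comp_def)
  have fxi: "integrable (M i) (\<lambda>y. f (x(i := y)))" if "x \<in> space (PiM J M)" for x
  proof (rule finite_measure.integrable_const_bound[OF prob_space.finite_measure[OF Mi] _ fxm[OF that]])
    show "AE y in M i. norm (f (x(i := y))) \<le> B"
      unfolding real_norm_def using insert.prems(2)[OF upd[OF that]] by (rule AE_I2)
  qed
  have gm [measurable]: "g \<in> borel_measurable (PiM J M)"
    unfolding g_def by measurable
  have int_f: "integrable (PiM (insert i J) M) f"
  proof (rule PI.integrable_const_bound[OF _ fm])
    show "AE x in PiM (insert i J) M. norm (f x) \<le> B"
      unfolding real_norm_def using insert.prems(2) by (rule AE_I2)
  qed
  have Eg: "(\<integral>z. f z \<partial>PiM (insert i J) M) = (\<integral>x. g x \<partial>PiM J M)"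
    unfolding g_def by (rule product_integral_insert[OF insert.hyps int_f])
  have g_bdd: "\<bar>g x\<bar> \<le> B" if "x \<in> space (PiM J M)" for x
  proof -
    have "\<bar>g x\<bar> \<le> (\<integral>y. \<bar>f (x(i := y))\<bar> \<partial>M i)" unfolding g_def by (rule integral_abs_bound)
    also have "\<dots> \<le> (\<integral>y. B \<partial>M i)"
    proof (rule integral_mono)
      show "\<bar>f (x(i := y))\<bar> \<le> B" if "y \<in> space (M i)" for y
        using insert.prems(2)[OF upd[OF \<open>x \<in> space (PiM J M)\<close> that]] .
    qed (use fxi[OF that] in auto)
    finally show ?thesis using prob_space.prob_space[OF Mi] by simp
  qed
  have g_diff: "\<bar>g x - g (x(j := y))\<bar> \<le> d j"
    if x: "x \<in> space (PiM J M)" and j: "j \<in> J" and y: "y \<in> space (M j)" for x j y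
  proof -
    have x': "x(j := y) \<in> space (PiM J M)" using x j y PiE_fun_upd[of y "\<lambda>i. space (M i)" j x J] by (simp add: space_PiM insert_absorb)
    have ji: "j \<noteq> i" using j insert.hyps by auto
    have "g x - g (x(j := y)) = (\<integral>z. f (x(i := z)) - f (x(j := y, i := z)) \<partial>M i)"
      unfolding g_def using fxi[OF x] fxi[OF x'] by (simp add: Bochner_Integration.integral_diff)
    also have "\<bar>\<dots>\<bar> \<le> (\<integral>z. \<bar>f (x(i := z)) - f (x(j := y, i := z))\<bar> \<partial>M i)" by (rule integral_abs_bound)
    also have "\<dots> \<le> (\<integral>z. d j \<partial>M i)"
    proof (rule integral_mono)
      fix z assume z: "z \<in> space (M i)"
      show "\<bar>f (x(i := z)) - f (x(j := y, i := z))\<bar> \<le> d j"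
        using insert.prems(3)[OF upd[OF x z], of j y] j y unfolding fun_upd_twist[OF ji] by blast
    qed (use fxi[OF x] fxi[OF x'] in auto)
    finally show ?thesis using prob_space.prob_space[OF Mi] by simp
  qed
  define e where "e = (\<integral>z. f z \<partial>PiM (insert i J) M)"
  have "(\<integral>\<^sup>+x. ennreal (exp (l * (f x - e))) \<partial>PiM (insert i J) M) =
      (\<integral>\<^sup>+x. (\<integral>\<^sup>+y. ennreal (exp (l * (f (x(i := y)) - e))) \<partial>M i) \<partial>PiM J M)"
    by (rule product_nn_integral_insert[OF insert.hyps]) measurable
  \<comment> \<open>The exponent is split as (f - g) + (g - e). The second summand is constant in
    \<open>y\<close>, and \<open>g x\<close> is the mean of the section, so Hoeffding's lemma
    handles the first.\<close>
  also have "\<dots> \<le> (\<integral>\<^sup>+x. ennreal (exp (l\<^sup>2 * (d i)\<^sup>2 / 8)) * ennreal (exp (l * (g x - e))) \<partial>PiM J M)"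
  proof (rule nn_integral_mono)
    fix x assume x: "x \<in> space (PiM J M)"
    note [measurable] = fxm[OF x]
    have "(\<integral>\<^sup>+y. ennreal (exp (l * (f (x(i := y)) - e))) \<partial>M i) =
        (\<integral>\<^sup>+y. ennreal (exp (l * (f (x(i := y)) - g x))) * ennreal (exp (l * (g x - e))) \<partial>M i)"
      by (intro nn_integral_cong) (simp add: ennreal_mult[symmetric] exp_add[symmetric] algebra_simps)
    also have "\<dots> = (\<integral>\<^sup>+y. ennreal (exp (l * (f (x(i := y)) - g x))) \<partial>M i) * ennreal (exp (l * (g x - e)))"
      by (rule nn_integral_multc) measurable
    also have "\<dots> \<le> ennreal (exp (l\<^sup>2 * (d i)\<^sup>2 / 8)) * ennreal (exp (l * (g x - e)))"
    proof (rule mult_right_mono)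
      show "(\<integral>\<^sup>+y. ennreal (exp (l * (f (x(i := y)) - g x))) \<partial>M i) \<le> ennreal (exp (l\<^sup>2 * (d i)\<^sup>2 / 8))"
        unfolding g_def
      proof (rule prob_space.Hoeffding_lemma_oscillation[OF Mi fxm[OF x] _ _ l])
        show "\<bar>f (x(i := y))\<bar> \<le> B" if "y \<in> space (M i)" for y
          using insert.prems(2) upd[OF x that] by blast
        show "f (x(i := y)) - f (x(i := z)) \<le> d i" if "y \<in> space (M i)" "z \<in> space (M i)" for y z
          using insert.prems(3)[OF upd[OF x that(1)] insertI1 that(2)] unfolding fun_upd_upd by linarith
      qed
    qed simp
    finally show "(\<integral>\<^sup>+y. ennreal (exp (l * (f (x(i := y)) - e))) \<partial>M i)
        \<le> ennreal (exp (l\<^sup>2 * (d i)\<^sup>2 / 8)) * ennreal (exp (l * (g x - e)))" .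
  qed
  also have "\<dots> = ennreal (exp (l\<^sup>2 * (d i)\<^sup>2 / 8)) * (\<integral>\<^sup>+x. ennreal (exp (l * (g x - e))) \<partial>PiM J M)"
    by (rule nn_integral_cmult) measurable
  also have "\<dots> \<le> ennreal (exp (l\<^sup>2 * (d i)\<^sup>2 / 8)) * ennreal (exp (l\<^sup>2 * (\<Sum>i\<in>J. (d i)\<^sup>2) / 8))"
    unfolding e_def Eg
    by (intro mult_left_mono insert.IH gm g_bdd g_diff) auto
  also have "\<dots> = ennreal (exp (l\<^sup>2 * (\<Sum>i\<in>insert i J. (d i)\<^sup>2) / 8))"
    using insert.hyps by (simp add: ennreal_mult[symmetric] exp_add[symmetric] algebra_simps add_divide_distrib)
  finally show ?case unfolding e_def .
qed

text \<open>Chernoff's method applied to \<open>- f\<close>, which turns the lower tail of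
  \<open>f\<close> into an upper tail.\<close>

lemma (in product_prob_space) McDiarmid_inequality_le:
  fixes f :: "('i \<Rightarrow> 'a) \<Rightarrow> real"
  assumes I: "finite I" and f [measurable]: "f \<in> borel_measurable (PiM I M)"
    and bdd: "\<And>x. x \<in> space (PiM I M) \<Longrightarrow> \<bar>f x\<bar> \<le> B"
    and diff: "\<And>x i y. x \<in> space (PiM I M) \<Longrightarrow> i \<in> I \<Longrightarrow> y \<in> space (M i) \<Longrightarrow> \<bar>f x - f (x(i := y))\<bar> \<le> d i"
    and S: "(\<Sum>i\<in>I. (d i)\<^sup>2) > 0" and t: "t > 0"
  shows "measure (PiM I M) {x \<in> space (PiM I M). f x \<le> (\<integral>z. f z \<partial>PiM I M) - t}
    \<le> exp (- 2 * t\<^sup>2 / (\<Sum>i\<in>I. (d i)\<^sup>2))"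
proof -
  interpret P: prob_space "PiM I M" by (intro prob_space_PiM prob_space)
  define s where "s = (\<Sum>i\<in>I. (d i)\<^sup>2)"
  \<comment> \<open>The minimiser of \<open>l\<^sup>2 * s / 8 - l * t\<close>, where the exponent
    takes the value \<open>- 2 * t\<^sup>2 / s\<close>.\<close>
  define l where "l = 4 * t / s"
  have s: "s > 0" using S by (simp add: s_def)
  then have l: "l > 0" using t by (simp add: l_def)
  define e where "e = (\<integral>z. f z \<partial>PiM I M)"
  have e': "(\<integral>z. - f z \<partial>PiM I M) = - e" by (simp add: e_def)
  define A where "A = {x \<in> space (PiM I M). f x \<le> e - t}"
  have [measurable]: "A \<in> sets (PiM I M)" unfolding A_def by measurable
  have "ennreal (exp (l * t)) * emeasure (PiM I M) A = (\<integral>\<^sup>+x. ennreal (exp (l * t)) * indicator A x \<partial>PiM I M)"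
    by (simp add: nn_integral_cmult_indicator)
  also have "\<dots> \<le> (\<integral>\<^sup>+x. ennreal (exp (l * (- f x - (\<integral>z. - f z \<partial>PiM I M)))) \<partial>PiM I M)"
  proof (rule nn_integral_mono)
    fix x
    have "l * t \<le> l * (e - f x)" if "f x \<le> e - t" using that l by (intro mult_left_mono) auto
    then show "ennreal (exp (l * t)) * indicator A x \<le> ennreal (exp (l * (- f x - (\<integral>z. - f z \<partial>PiM I M))))"
      unfolding e' by (auto simp: A_def split: split_indicator)
  qed
  also have "\<dots> \<le> ennreal (exp (l\<^sup>2 * s / 8))"
    unfolding s_def
  proof (rule bounded_differences_mgf[OF I _ _ _ l])
    show "\<bar>- f x\<bar> \<le> B" if "x \<in> space (PiM I M)" for x using bdd[OF that] by simp
    show "\<bar>- f x - - f (x(i := y))\<bar> \<le> d i"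
      if "x \<in> space (PiM I M)" "i \<in> I" "y \<in> space (M i)" for x i y
      using diff[OF that] by (simp add: abs_minus_commute)
  qed measurable
  finally have "exp (l * t) * measure (PiM I M) A \<le> exp (l\<^sup>2 * s / 8)"
    by (simp add: P.emeasure_eq_measure ennreal_mult[symmetric])
  then have "measure (PiM I M) A \<le> exp (l\<^sup>2 * s / 8) / exp (l * t)"
    by (simp add: field_simps)
  also have "\<dots> = exp (l\<^sup>2 * s / 8 - l * t)" by (simp add: exp_diff)
  also have "l\<^sup>2 * s / 8 - l * t = - 2 * t\<^sup>2 / s"
    using s by (simp add: l_def field_simps power2_eq_square)
  finally show ?thesis unfolding A_def e_def s_def .
qed

section \<open>Ranking as a random variable\<close>

lemma prob_space_uniform_unit: "prob_space (uniform_measure lborel {0..1::real})"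
  by (rule prob_space_uniform_measure) auto

lemma prob_space_rank_space: "prob_space (rank_space V)"
  unfolding rank_space_def by (intro prob_space_PiM prob_space_uniform_unit)

lemma measurable_rank_space_component:
  assumes "k \<in> V"
  shows "(\<lambda>x. x k) \<in> borel_measurable (rank_space V)"
proof -
  have "(\<lambda>x. x k) \<in> rank_space V \<rightarrow>\<^sub>M uniform_measure lborel {0..1::real}"
    unfolding rank_space_def by (rule measurable_component_singleton[OF assms])
  also have "rank_space V \<rightarrow>\<^sub>M uniform_measure lborel {0..1::real} = borel_measurable (rank_space V)"
    by (rule measurable_cong_sets) simp_all
  finally show ?thesis .
qed

lemma AE_rank_space_inj_on:
  assumes "finite V"
  shows "AE x in rank_space V. inj_on x V"
proof -
  let ?\<mu> = "uniform_measure lborel {0..1::real}"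
  interpret product_prob_space "\<lambda>_. ?\<mu>" V
    by (intro product_prob_spaceI prob_space_uniform_unit)
  have "AE x in rank_space V. x i \<noteq> x j" if ij: "i \<in> V" "j \<in> V" "i \<noteq> j" for i j
  proof -
    define J where "J = V - {i}"
    have V: "V = insert i J" "finite J" "i \<notin> J" "j \<in> J" using ij assms by (auto simp: J_def)
    define N where "N = {x \<in> space (PiM V (\<lambda>_. ?\<mu>)). x i = x j}"
    have N: "N \<in> sets (PiM (insert i J) (\<lambda>_. ?\<mu>))"
      using ij unfolding N_def V(1)[symmetric] rank_space_def[symmetric]
      by (intro borel_measurable_eq measurable_rank_space_component)
    have "emeasure (PiM V (\<lambda>_. ?\<mu>)) N = (\<integral>\<^sup>+x. indicator N x \<partial>PiM (insert i J) (\<lambda>_. ?\<mu>))"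
      using N V by simp
    also have "\<dots> = (\<integral>\<^sup>+x. (\<integral>\<^sup>+y. indicator N (x(i := y)) \<partial>?\<mu>) \<partial>PiM J (\<lambda>_. ?\<mu>))"
      using N V by (intro product_nn_integral_insert) auto
    \<comment> \<open>With the other ranks fixed, membership in \<open>N\<close> forces the rank of
      \<open>i\<close> to be \<open>x j\<close>, a single point, which has measure zero.\<close>
    also have "\<dots> \<le> (\<integral>\<^sup>+x. (\<integral>\<^sup>+y. indicator {x j} y \<partial>?\<mu>) \<partial>PiM J (\<lambda>_. ?\<mu>))"
      using ij by (intro nn_integral_mono) (auto simp: N_def split: split_indicator)
    also have "\<dots> = 0" by (simp add: emeasure_lborel_countable)
    finally have "N \<in> null_sets (PiM V (\<lambda>_. ?\<mu>))" using N V by (auto simp: null_sets_def)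
    then show ?thesis
      unfolding rank_space_def by (rule AE_I') (auto simp: N_def)
  qed
  then have "AE x in rank_space V. \<forall>i\<in>V. \<forall>j\<in>V. i \<noteq> j \<longrightarrow> x i \<noteq> x j"
    using assms by (intro AE_finite_allI) auto
  then show ?thesis by (rule eventually_mono) (auto simp: inj_on_def)
qed

text \<open>Such a \<open>g\<close> factors through the order pattern \<open>p x\<close>, which
  takes finitely many values on measurable sets. Hence \<open>g\<close> is measurable even for the
  discrete sigma algebra on its codomain.\<close>

lemma measurable_rank_space_order_invariant:
  assumes V: "finite V"
    and g: "\<And>x y. (\<And>u v. u \<in> V \<Longrightarrow> v \<in> V \<Longrightarrow> x u < x v \<longleftrightarrow> y u < y v) \<Longrightarrow> g x = g y"
  shows "g \<in> rank_space V \<rightarrow>\<^sub>M count_space UNIV"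
proof -
  define p where "p x = {(u, v). u \<in> V \<and> v \<in> V \<and> x u < x v}" for x :: "'a \<Rightarrow> real"
  have fin: "finite (Pow (V \<times> V))" using V by simp
  have pm: "p \<in> rank_space V \<rightarrow>\<^sub>M count_space (Pow (V \<times> V))"
    unfolding measurable_count_space_eq2[OF fin]
  proof (intro conjI ballI)
    fix q assume "q \<in> Pow (V \<times> V)"
    then have "p x = q \<longleftrightarrow> (\<forall>u\<in>V. \<forall>v\<in>V. x u < x v \<longleftrightarrow> (u, v) \<in> q)" for x
      unfolding p_def set_eq_iff split_paired_All mem_Collect_eq case_prod_conv by blast
    then have "p -` {q} \<inter> space (rank_space V) =
        {x \<in> space (rank_space V). \<forall>u\<in>V. \<forall>v\<in>V. x u < x v \<longleftrightarrow> (u, v) \<in> q}"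
      by (intro set_eqI) (simp add: conj_commute)
    also have "\<dots> \<in> sets (rank_space V)"
    proof (intro sets.sets_Collect_finite_All V)
      fix u v assume u: "u \<in> V" and v: "v \<in> V"
      note uv = measurable_rank_space_component[OF u] measurable_rank_space_component[OF v]
      have "{x \<in> space (rank_space V). \<not> x u < x v} \<in> sets (rank_space V)"
        unfolding not_less by (rule borel_measurable_le[OF uv(2,1)])
      with borel_measurable_less[OF uv]
      show "{x \<in> space (rank_space V). x u < x v \<longleftrightarrow> (u, v) \<in> q} \<in> sets (rank_space V)"
        by (cases "(u, v) \<in> q") simp_all
    qed
    finally show "p -` {q} \<inter> space (rank_space V) \<in> sets (rank_space V)" .
  qed (auto simp: p_def)
  \<comment> \<open>\<open>SOME\<close> picks one representative rank vector for each pattern, so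
    that \<open>g\<close> becomes a function of \<open>p x\<close>.\<close>
  have "g x = g (SOME y. p y = p x)" for x
  proof (rule g)
    fix u v assume uv: "u \<in> V" "v \<in> V"
    have "p (SOME y. p y = p x) = p x" by (rule someI[of _ x]) simp
    then have "(u, v) \<in> p (SOME y. p y = p x) \<longleftrightarrow> (u, v) \<in> p x" by (rule arg_cong)
    moreover have "(u, v) \<in> p z \<longleftrightarrow> z u < z v" for z using uv by (simp add: p_def)
    ultimately show "x u < x v \<longleftrightarrow> (SOME y. p y = p x) u < (SOME y. p y = p x) v" by simp
  qed
  then have "g = (\<lambda>q. g (SOME y. p y = q)) \<circ> p" unfolding fun_eq_iff o_apply by blast
  also have "\<dots> \<in> rank_space V \<rightarrow>\<^sub>M count_space UNIV"
    by (rule measurable_comp[OF pm]) simp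
  finally show ?thesis .
qed

lemma simple_graphD:
  assumes "simple_graph V E"
  shows "finite V" "E u v \<Longrightarrow> u \<in> V" "E u v \<Longrightarrow> v \<in> V" "E u v \<Longrightarrow> E v u" "\<not> E v v"
  using assms unfolding simple_graph_def by blast+

lemma measurable_card_ranking_matching:
  assumes "simple_graph V E"
  shows "(\<lambda>x. real (card (ranking_matching E \<sigma> x))) \<in> borel_measurable (rank_space V)"
proof -
  have "ranking_matching E \<sigma> \<in> rank_space V \<rightarrow>\<^sub>M count_space UNIV"
  proof (rule measurable_rank_space_order_invariant[OF simple_graphD(1)[OF assms]])
    fix x y :: "'a \<Rightarrow> real" assume "\<And>u v. u \<in> V \<Longrightarrow> v \<in> V \<Longrightarrow> x u < x v \<longleftrightarrow> y u < y v"
    then have "arg_min_on x C = arg_min_on y C" if "C \<subseteq> V" for C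
      using that by (intro arg_min_on_order_cong) blast
    then show "ranking_matching E \<sigma> x = ranking_matching E \<sigma> y"
      using simple_graphD(3)[OF assms] by (intro ranking_matching_cong[where V = V])
  qed
  then show ?thesis by (rule measurable_compose) simp
qed

lemma measurable_avail_run_lex_choice:
  assumes "finite V" "W \<subseteq> V"
  shows "(\<lambda>x. real (snd (avail_run E (lex_choice h x) W \<sigma>))) \<in> borel_measurable (rank_space V)"
proof -
  have "(\<lambda>x. avail_run E (lex_choice h x) W \<sigma>) \<in> rank_space V \<rightarrow>\<^sub>M count_space UNIV"
  proof (rule measurable_rank_space_order_invariant[OF assms(1)])
    fix x y :: "'a \<Rightarrow> real" assume "\<And>u v. u \<in> V \<Longrightarrow> v \<in> V \<Longrightarrow> x u < x v \<longleftrightarrow> y u < y v"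
    then have "lex_choice h x C = lex_choice h y C" if "C \<subseteq> W" for C
      using that assms(2) by (intro lex_choice_order_cong) blast
    then show "avail_run E (lex_choice h x) W \<sigma> = avail_run E (lex_choice h y) W \<sigma>"
      by (rule avail_run_cong)
  qed
  then show ?thesis by (rule measurable_compose) simp
qed

section \<open>Transfer to graphs on the natural numbers\<close>

text \<open>Ties are excluded because the Hilbert choice in \<open>arg_min_on\<close> need not
  commute with \<open>h\<close> when there are several minimisers. The pulled back ranks are
  restricted to \<open>V\<close> because points of the product space are extensional.\<close>

lemma ranking_matching_relabel:
  assumes G: "simple_graph V E" and \<sigma>: "set \<sigma> \<subseteq> Arr ` V \<union> Dep ` V"
    and h: "inj_on h V" and y: "inj_on y (h ` V)"
  shows "ranking_matching (\<lambda>a b. \<exists>u v. a = h u \<and> b = h v \<and> E u v) (map (map_event h) \<sigma>) y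
    = (`) h ` ranking_matching E \<sigma> (\<lambda>u\<in>V. y (h u))"
proof -
  let ?E = "\<lambda>a b. \<exists>u v. a = h u \<and> b = h v \<and> E u v"
  define x where "x = (\<lambda>u\<in>V. y (h u))"
  have x: "x u = y (h u)" if "u \<in> V" for u using that by (simp add: x_def)
  note G' = simple_graphD[OF G]
  have E: "?E (h u) (h v) \<longleftrightarrow> E u v" if "u \<in> V" "v \<in> V" for u v
  proof
    assume "?E (h u) (h v)"
    then obtain u' v' where uv: "h u = h u'" "h v = h v'" "E u' v'" by blast
    have "u = u'" "v = v'" using h uv(1,2) that G'(2,3)[OF uv(3)] by (auto dest: inj_onD)
    with uv(3) show "E u v" by simp
  qed blast
  have am: "arg_min_on y (h ` C) = h (arg_min_on x C)" if C: "C \<subseteq> V" "C \<noteq> {}" for C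
  proof -
    have fin: "finite C" using C(1) G'(1) by (rule finite_subset)
    let ?u = "arg_min_on x C"
    have u: "?u \<in> C" using fin C by (intro arg_min_if_finite(1))
    have "arg_min_on y (h ` C) = lex_choice (\<lambda>_. 0) y (h ` C)"
      using fin C y by (intro arg_min_on_eq_lex_choice) (auto intro: inj_on_subset)
    also have "\<dots> = h ?u"
    proof (rule lex_choice_unique)
      fix b assume b: "b \<in> h ` C" "b \<noteq> h ?u"
      then obtain v where v: "v \<in> C" "b = h v" by blast
      have "x ?u \<le> x v" using arg_min_least[OF fin C(2) v(1)] .
      moreover have uv: "?u \<in> V" "v \<in> V" using u v C by blast+
      ultimately have "y (h ?u) \<le> y b" using v x by simp
      moreover have "y (h ?u) \<noteq> y b"
        using inj_onD[OF y, of "h ?u" b] b v uv by blast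
      ultimately show "y (h ?u) < y b \<or> y (h ?u) = y b \<and> (0::nat) < 0" by simp
    qed (use u in blast)
    finally show ?thesis .
  qed
  have "\<exists>A M. foldl (ranking_step E x) ({}, {}) \<sigma> = (A, M) \<and> A \<subseteq> V \<and> M \<subseteq> Pow V \<and>
      foldl (ranking_step ?E y) ({}, {}) (map (map_event h) \<sigma>) = (h ` A, (`) h ` M)"
    using \<sigma>
  proof (induction \<sigma> rule: rev_induct)
    case (snoc e \<sigma>)
    have "set \<sigma> \<subseteq> Arr ` V \<union> Dep ` V" using snoc.prems by simp
    from snoc.IH[OF this] obtain A M where IH: "foldl (ranking_step E x) ({}, {}) \<sigma> = (A, M)" "A \<subseteq> V" "M \<subseteq> Pow V"
      "foldl (ranking_step ?E y) ({}, {}) (map (map_event h) \<sigma>) = (h ` A, (`) h ` M)" by blast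
    show ?case
    proof (cases e)
      case (Arr v)
      then show ?thesis using IH snoc.prems by auto
    next
      case (Dep i)
      have i: "i \<in> V" using snoc.prems Dep by auto
      define C where "C = {j \<in> A. E i j \<and> j \<notin> \<Union>M}"
      have CV: "C \<subseteq> V" using IH by (auto simp: C_def)
      have matched: "h u \<in> \<Union>((`) h ` M) \<longleftrightarrow> u \<in> \<Union>M" if "u \<in> V" for u
      proof -
        have "h u \<in> h ` \<Union>M \<longleftrightarrow> u \<in> \<Union>M"
          using that h IH(3) by (intro inj_on_image_mem_iff) auto
        moreover have "h ` \<Union>M = \<Union>((`) h ` M)" by blast
        ultimately show ?thesis by simp
      qed
      have C': "{b \<in> h ` A. ?E (h i) b \<and> b \<notin> \<Union>((`) h ` M)} = h ` C"
      proof -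
        have "{j \<in> A. ?E (h i) (h j) \<and> h j \<notin> \<Union>((`) h ` M)} = C"
          unfolding C_def using E[OF i] matched IH(2) by (intro Collect_cong) blast
        moreover have "{b \<in> h ` A. P b} = h ` {j \<in> A. P (h j)}" for P by blast
        ultimately show ?thesis by simp
      qed
      have 1: "foldl (ranking_step E x) ({}, {}) (\<sigma> @ [e]) =
          (if i \<in> \<Union>M \<or> C = {} then (A, M) else (A, insert {i, arg_min_on x C} M))"
        by (simp only: foldl_append IH Dep C_def foldl.simps ranking_step_Dep)
      have 2: "foldl (ranking_step ?E y) ({}, {}) (map (map_event h) (\<sigma> @ [e])) =
          (if h i \<in> \<Union>((`) h ` M) \<or> h ` C = {} then (h ` A, (`) h ` M)
           else (h ` A, insert {h i, arg_min_on y (h ` C)} ((`) h ` M)))"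
        by (simp only: foldl_append map_append list.map event.map IH Dep foldl.simps ranking_step_Dep C')
      show ?thesis
      proof (cases "i \<in> \<Union>M \<or> C = {}")
        case True
        then show ?thesis unfolding 1 2 matched[OF i] using IH by auto
      next
        case False
        have "finite C" using CV G' by (auto intro: finite_subset)
        then have "arg_min_on x C \<in> V"
          using False CV arg_min_if_finite(1)[of C x] by blast
        then show ?thesis unfolding 1 2 matched[OF i]
          using IH False i am[OF CV] by auto
      qed
    qed
  qed simp
  then show ?thesis unfolding ranking_matching_def x_def by auto
qed

section \<open>Matchings and the competitive ratio for an arbitrary vertex type\<close>

lemma is_matching_subset_Pow:
  assumes "simple_graph V E" "is_matching E M"
  shows "M \<subseteq> Pow V"
  using assms simple_graphD(2,3)[OF assms(1)] unfolding is_matching_def by fastforce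

lemma card_le_max_matching_size:
  assumes "simple_graph V E" "is_matching E M"
  shows "card M \<le> max_matching_size E"
proof -
  have "{card M | M. is_matching E M} \<subseteq> card ` Pow (Pow V)"
    using is_matching_subset_Pow[OF assms(1)] by auto
  then have "finite {card M | M. is_matching E M}"
    by (rule finite_subset) (simp add: simple_graphD(1)[OF assms(1)])
  then show ?thesis unfolding max_matching_size_def using assms(2) by (intro Max_ge) auto
qed

lemma expected_ranking_size_nonneg: "expected_ranking_size V E \<sigma> \<ge> 0"
  unfolding expected_ranking_size_def by simp

lemma expected_ranking_size_relabel:
  assumes G: "simple_graph V E" and \<sigma>: "valid_order V E \<sigma>" and h: "inj_on h V"
    and G2: "simple_graph (h ` V) (\<lambda>a b. \<exists>u v. a = h u \<and> b = h v \<and> E u v)"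
  shows "expected_ranking_size (h ` V) (\<lambda>a b. \<exists>u v. a = h u \<and> b = h v \<and> E u v) (map (map_event h) \<sigma>)
    = expected_ranking_size V E \<sigma>"
proof -
  let ?E = "\<lambda>a b. \<exists>u v. a = h u \<and> b = h v \<and> E u v"
  let ?T = "\<lambda>y. \<lambda>u\<in>V. y (h u) :: real"
  have distr: "distr (rank_space (h ` V)) (rank_space V) ?T = rank_space V"
    unfolding rank_space_def
    using distr_PiM_reindex[of "h ` V" "\<lambda>_. uniform_measure lborel {0..1::real}" h V] h prob_space_uniform_unit
    by auto
  have T: "?T \<in> rank_space (h ` V) \<rightarrow>\<^sub>M rank_space V"
    unfolding rank_space_def
    by (intro measurable_restrict measurable_component_singleton) auto
  have "expected_ranking_size V E \<sigma> = (\<integral>x. real (card (ranking_matching E \<sigma> x)) \<partial>distr (rank_space (h ` V)) (rank_space V) ?T)"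
    by (simp add: distr expected_ranking_size_def)
  also have "\<dots> = (\<integral>y. real (card (ranking_matching E \<sigma> (?T y))) \<partial>rank_space (h ` V))"
    by (rule integral_distr[OF T measurable_card_ranking_matching[OF G]])
  also have "\<dots> = expected_ranking_size (h ` V) ?E (map (map_event h) \<sigma>)"
    unfolding expected_ranking_size_def
  proof (rule integral_cong_AE)
    show "(\<lambda>y. real (card (ranking_matching E \<sigma> (?T y)))) \<in> borel_measurable (rank_space (h ` V))"
      by (rule measurable_compose[OF T measurable_card_ranking_matching[OF G]])
    show "(\<lambda>y. real (card (ranking_matching ?E (map (map_event h) \<sigma>) y))) \<in> borel_measurable (rank_space (h ` V))"
      by (rule measurable_card_ranking_matching[OF G2])
    have "AE y in rank_space (h ` V). inj_on y (h ` V)"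
      using simple_graphD(1)[OF G2] by (rule AE_rank_space_inj_on)
    then show "AE y in rank_space (h ` V). real (card (ranking_matching E \<sigma> (?T y))) =
        real (card (ranking_matching ?E (map (map_event h) \<sigma>) y))"
    proof (rule eventually_mono)
      fix y assume y: "inj_on (y :: _ \<Rightarrow> real) (h ` V)"
      have sub: "set \<sigma> \<subseteq> Arr ` V \<union> Dep ` V" using \<sigma> by (auto simp: valid_order_def)
      have "ranking_matching E \<sigma> (?T y) \<subseteq> Pow V"
        using simple_graphD[OF G] by (intro ranking_matching_subset) auto
      then have "inj_on ((`) h) (ranking_matching E \<sigma> (?T y))"
        using inj_on_image_Pow[OF h] by (rule inj_on_subset[rotated])
      then show "real (card (ranking_matching E \<sigma> (?T y))) =
          real (card (ranking_matching ?E (map (map_event h) \<sigma>) y))"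
        unfolding ranking_matching_relabel[OF G sub h y] by (simp add: card_image)
    qed
  qed
  finally show ?thesis ..
qed

lemma simple_graph_relabel:
  assumes "simple_graph V E" "inj_on h V"
  shows "simple_graph (h ` V) (\<lambda>a b. \<exists>u v. a = h u \<and> b = h v \<and> E u v)"
  unfolding simple_graph_def
proof (intro conjI allI impI)
  note G = simple_graphD[OF assms(1)]
  show "finite (h ` V)" using G(1) by simp
  show "\<nexists>u v. a = h u \<and> a = h v \<and> E u v" for a
    using assms(2) G(2,3,5) by (metis inj_onD)
  fix a b assume "\<exists>u v. a = h u \<and> b = h v \<and> E u v"
  then obtain u v where "a = h u" "b = h v" "E u v" by blast
  then show "\<exists>u v. b = h u \<and> a = h v \<and> E u v" "a \<in> h ` V" "b \<in> h ` V"
    using G(2-4) by blast+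
qed

lemma valid_order_relabel:
  assumes "valid_order V E \<sigma>" "inj_on h V"
  shows "valid_order (h ` V) (\<lambda>a b. \<exists>u v. a = h u \<and> b = h v \<and> E u v) (map (map_event h) \<sigma>)"
proof -
  have set: "set \<sigma> = Arr ` V \<union> Dep ` V" and dist: "distinct \<sigma>"
    using assms(1) by (auto simp: valid_order_def)
  have "inj_on (map_event h) (set \<sigma>)"
    unfolding set by (rule inj_onI) (auto dest: inj_onD[OF assms(2)])
  then have dist': "distinct (map (map_event h) \<sigma>)" using dist by (simp add: distinct_map)
  have set': "set (map (map_event h) \<sigma>) = Arr ` h ` V \<union> Dep ` h ` V"
    by (simp add: set image_Un image_image)
  have pos: "\<exists>i<length (map (map_event h) \<sigma>). \<exists>j<length (map (map_event h) \<sigma>). i < j \<and>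
      map (map_event h) \<sigma> ! i = Arr (h u) \<and> map (map_event h) \<sigma> ! j = Dep (h v)"
    if "\<exists>i<length \<sigma>. \<exists>j<length \<sigma>. i < j \<and> \<sigma> ! i = Arr u \<and> \<sigma> ! j = Dep v" for u v
  proof -
    from that obtain i j where "i < length \<sigma>" "j < length \<sigma>" "i < j" "\<sigma> ! i = Arr u" "\<sigma> ! j = Dep v"
      by blast
    then show ?thesis by (intro exI[of _ i] exI[of _ j] conjI) simp_all
  qed
  show ?thesis unfolding valid_order_def
  proof (intro conjI ballI allI impI)
    fix a assume "a \<in> h ` V"
    then obtain v where "v \<in> V" "a = h v" by blast
    then show "\<exists>i<length (map (map_event h) \<sigma>). \<exists>j<length (map (map_event h) \<sigma>). i < j \<and>
        map (map_event h) \<sigma> ! i = Arr a \<and> map (map_event h) \<sigma> ! j = Dep a"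
      using assms(1) by (simp only: valid_order_def) (rule pos, blast)
  next
    fix a b assume "\<exists>u v. a = h u \<and> b = h v \<and> E u v"
    then obtain u v where "a = h u" "b = h v" "E u v" by blast
    then show "\<exists>i<length (map (map_event h) \<sigma>). \<exists>j<length (map (map_event h) \<sigma>). i < j \<and>
        map (map_event h) \<sigma> ! i = Arr a \<and> map (map_event h) \<sigma> ! j = Dep b"
      using assms(1) by (simp only: valid_order_def) (rule pos, blast)
  qed (fact dist' set')+
qed

lemma is_matching_relabel:
  assumes "simple_graph V E" "inj_on h V" "is_matching E M"
  shows "is_matching (\<lambda>a b. \<exists>u v. a = h u \<and> b = h v \<and> E u v) ((`) h ` M)"
  unfolding is_matching_def
proof (intro conjI ballI impI)
  fix e assume "e \<in> (`) h ` M"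
  then obtain e' where e': "e' \<in> M" "e = h ` e'" by blast
  then obtain u v where "E u v" "e' = {u, v}" using assms(3) unfolding is_matching_def by metis
  with e' have "e = {h u, h v} \<and> (\<exists>u' v'. h u = h u' \<and> h v = h v' \<and> E u' v')" by auto
  then show "\<exists>a b. e = {a, b} \<and> (\<exists>u v. a = h u \<and> b = h v \<and> E u v)" by blast
next
  fix e f assume "e \<in> (`) h ` M" "f \<in> (`) h ` M" "e \<noteq> f"
  then obtain e' f' where ef: "e = h ` e'" "f = h ` f'" "e' \<in> M" "f' \<in> M" "e' \<noteq> f'" by blast
  have "e' \<inter> f' = {}" using assms(3) ef(3-5) unfolding is_matching_def by metis
  moreover have "e' \<subseteq> V" "f' \<subseteq> V" using is_matching_subset_Pow[OF assms(1,3)] ef(3,4) by blast+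
  ultimately show "e \<inter> f = {}" using inj_on_image_Int[OF assms(2), of e' f'] ef by simp
qed

text \<open>A relabelled copy of the instance takes part in the infimum. The ratio refers to a
  maximum matching, but as it is nonnegative it may also be multiplied by the size of any other
  matching.\<close>

lemma ranking_ratio_le_expected_ranking_size:
  assumes G: "simple_graph V E" and \<sigma>: "valid_order V E \<sigma>" and M: "is_matching E M"
  shows "ranking_ratio * real (card M) \<le> expected_ranking_size V E \<sigma>"
proof (cases "card M = 0")
  case True
  then show ?thesis by (simp add: expected_ranking_size_nonneg)
next
  case False
  obtain h :: "'a \<Rightarrow> nat" where h: "inj_on h V"
    using finite_imp_inj_to_nat_seg[OF simple_graphD(1)[OF G]] by blast
  let ?E = "\<lambda>a b. \<exists>u v. a = h u \<and> b = h v \<and> E u v"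
  let ?R = "{expected_ranking_size V E \<sigma> / real (max_matching_size E) | V E \<sigma>.
      simple_graph (V :: nat set) E \<and> valid_order V E \<sigma> \<and> max_matching_size E > 0}"
  note G2 = simple_graph_relabel[OF G h]
  have "card ((`) h ` M) = card M"
    using is_matching_subset_Pow[OF G M] inj_on_image_Pow[OF h] by (intro card_image) (rule inj_on_subset)
  then have n: "card M \<le> max_matching_size ?E"
    using card_le_max_matching_size[OF G2 is_matching_relabel[OF G h M]] by simp
  let ?r = "expected_ranking_size (h ` V) ?E (map (map_event h) \<sigma>) / real (max_matching_size ?E)"
  have in_R: "?r \<in> ?R"
    unfolding mem_Collect_eq using G2 valid_order_relabel[OF \<sigma> h] n False
    by (intro exI[of _ "h ` V"] exI[of _ ?E] exI[of _ "map (map_event h) \<sigma>"] conjI refl) simp_all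
  have nonneg: "r \<ge> 0" if "r \<in> ?R" for r
    using that by (auto simp: expected_ranking_size_nonneg)
  have "ranking_ratio \<le> ?r"
    unfolding ranking_ratio_def using in_R nonneg by (intro cInf_lower bdd_belowI[of _ 0]) blast+
  moreover have "0 \<le> ranking_ratio"
    unfolding ranking_ratio_def using in_R nonneg by (intro cInf_greatest) blast+
  ultimately have "ranking_ratio * real (card M) \<le> ?r * real (max_matching_size ?E)"
    using n by (intro mult_mono) auto
  also have "\<dots> = expected_ranking_size V E \<sigma>"
    using n False expected_ranking_size_relabel[OF G \<sigma> h G2] by simp
  finally show ?thesis .
qed

section \<open>Concentration\<close>

text \<open>Used with \<open>W\<close> the vertex set of the matching and with \<open>W = V\<close>.
  Both runs then read the same rank vector, the coupling under which they are compared.\<close>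

lemma AE_card_ranking_matching_eq_avail_run:
  assumes G: "simple_graph V E" and \<sigma>: "valid_order V E \<sigma>" and W: "W \<subseteq> V"
  shows "AE x in rank_space V. card (ranking_matching (\<lambda>u v. E u v \<and> u \<in> W \<and> v \<in> W) \<sigma> x)
    = snd (avail_run E (lex_choice h x) W \<sigma>)"
  using AE_rank_space_inj_on[OF simple_graphD(1)[OF G]]
proof (rule eventually_mono)
  fix x :: "'a \<Rightarrow> real" assume x: "inj_on x V"
  have fin: "finite W" using W simple_graphD(1)[OF G] by (rule finite_subset)
  show "card (ranking_matching (\<lambda>u v. E u v \<and> u \<in> W \<and> v \<in> W) \<sigma> x)
    = snd (avail_run E (lex_choice h x) W \<sigma>)"
  proof (rule avail_run_simulates_ranking[OF valid_order_imp_well_ordered_events[OF \<sigma>] fin])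
    show "arg_min_on x C = lex_choice h x C" if "C \<subseteq> W" "C \<noteq> {}" for C
    proof (rule arg_min_on_eq_lex_choice)
      show "finite C" using that fin by (blast intro: finite_subset)
      show "inj_on x C" using x that W by (blast intro: inj_on_subset)
    qed (use that in blast)
  qed (use simple_graphD(5)[OF G] in auto)
qed

text \<open>A crude bound, sufficient as the uniform bound on the function in McDiarmid's
  inequality.\<close>

lemma avail_run_le_card:
  assumes "consistent_choice V c" "\<forall>u v. E u v \<longrightarrow> v \<in> V \<and> u \<noteq> v" "distinct \<sigma>" "finite W"
  shows "snd (avail_run E c W \<sigma>) \<le> card W"
  using assms(4)
proof induction
  case empty
  have "avail_run E c {} \<sigma> = ({}, 0)"
  proof (induction \<sigma> rule: rev_induct)
    case (snoc e \<sigma>)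
    then show ?case by (cases e) (auto simp: avail_run_def)
  qed (simp add: avail_run_def)
  then show ?case by simp
next
  case (insert w W)
  then show ?case using avail_run_insert_bounds(2)[OF assms(1-3), of w W] by simp
qed

lemma card_Union_matching_le:
  assumes "is_matching E M" "finite M"
  shows "card (\<Union>M) \<le> 2 * card M"
proof -
  have "card (\<Union>M) \<le> (\<Sum>e\<in>M. card e)" by (rule card_Union_le_sum_card)
  also have "\<dots> \<le> (\<Sum>e\<in>M. 2)"
    using assms(1) unfolding is_matching_def by (intro sum_mono) (auto simp: card_insert_if)
  finally show ?thesis by simp
qed

text \<open>The run on \<open>W - {i}\<close> is the same for both rank vectors, and restoring
  \<open>i\<close> adds 0 or 1 to either count. The difference 0 for \<open>i\<close> outside
  \<open>W\<close> keeps the sum of squares at \<open>card W\<close> rather than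
  \<open>card V\<close>.\<close>

lemma avail_run_bounded_difference:
  assumes V: "finite V" "inj_on h V" and W: "W \<subseteq> V"
    and E: "\<forall>u v. E u v \<longrightarrow> v \<in> V \<and> u \<noteq> v" and \<sigma>: "distinct \<sigma>"
  shows "\<bar>real (snd (avail_run E (lex_choice h x) W \<sigma>)) - real (snd (avail_run E (lex_choice h (x(i := y))) W \<sigma>))\<bar>
    \<le> (if i \<in> W then 1 else 0)"
proof -
  have eq: "avail_run E (lex_choice h x) (W - {i}) \<sigma> = avail_run E (lex_choice h (x(i := y))) (W - {i}) \<sigma>"
    by (intro avail_run_cong lex_choice_order_cong) auto
  show ?thesis
  proof (cases "i \<in> W")
    case False
    then show ?thesis using eq by simp
  next
    case True
    then have "W = insert i (W - {i})" by blast
    then show ?thesis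
      using avail_run_insert_bounds[where W = "W - {i}" and v = i, OF consistent_choice_lex_choice[OF V, of x] E \<sigma>]
        avail_run_insert_bounds[where W = "W - {i}" and v = i, OF consistent_choice_lex_choice[OF V, of "x(i := y)"] E \<sigma>]
        True unfolding eq by (auto simp: insert_absorb)
  qed
qed

lemma nat_valued_lower_tail_strict:
  fixes f :: "'a \<Rightarrow> nat" and e t :: real
  assumes "\<And>s. s > 0 \<Longrightarrow> measure N {x \<in> space N. real (f x) \<le> e - s} \<le> exp (- c * s\<^sup>2)" and "c > 0" "t > 0"
  shows "measure N {x \<in> space N. real (f x) < e - t} < exp (- c * t\<^sup>2)"
proof -
  \<comment> \<open>\<open>\<lceil>e - t\<rceil> - 1\<close> is the largest integer strictly below
    \<open>e - t\<close>. The event is thus a deviation of at least \<open>s\<close>, which exceeds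
    \<open>t\<close>, and the bound at \<open>s\<close> is strictly smaller.\<close>
  define s where "s = e - of_int (\<lceil>e - t\<rceil> - 1)"
  have s: "t < s" unfolding s_def by linarith
  have eq: "real (f x) < e - t \<longleftrightarrow> real (f x) \<le> e - s" for x
  proof -
    have "real (f x) < e - t \<longleftrightarrow> int (f x) < \<lceil>e - t\<rceil>" by (simp add: less_ceiling_iff)
    also have "\<dots> \<longleftrightarrow> int (f x) \<le> \<lceil>e - t\<rceil> - 1" by linarith
    also have "\<dots> \<longleftrightarrow> real (f x) \<le> e - s" unfolding s_def by linarith
    finally show ?thesis .
  qed
  have "measure N {x \<in> space N. real (f x) < e - t} \<le> exp (- c * s\<^sup>2)"
    unfolding eq using s assms(1)[of s] assms(3) by simp
  also have "\<dots> < exp (- c * t\<^sup>2)"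
    using s assms(2,3) by (simp add: power_strict_mono)
  finally show ?thesis .
qed

lemma valid_order_subgraph:
  assumes "valid_order V E \<sigma>" "\<And>u v. F u v \<Longrightarrow> E u v"
  shows "valid_order V F \<sigma>"
proof -
  have "\<exists>i<length \<sigma>. \<exists>j<length \<sigma>. i < j \<and> \<sigma> ! i = Arr u \<and> \<sigma> ! j = Dep v" if "F u v" for u v
    using assms(1) assms(2)[OF that] by (simp add: valid_order_def)
  then show ?thesis using assms(1) by (simp add: valid_order_def)
qed

theorem theorem2:
  fixes V :: "'v set" and E :: "'v \<Rightarrow> 'v \<Rightarrow> bool" and \<sigma> :: "'v event list"
    and n :: nat and \<alpha> :: real
  assumes "simple_graph V E" and "valid_order V E \<sigma>"
    and "\<exists>M. is_matching E M \<and> card M = n"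
    and "\<alpha> > 0"
  shows "measure (rank_space V)
           {x \<in> space (rank_space V). real (card (ranking_matching E \<sigma> x)) < (ranking_ratio - \<alpha>) * real n}
         < exp (- (\<alpha>\<^sup>2) * real n)"
proof (cases "n = 0")
  case True
  \<comment> \<open>The threshold is 0, so the event is empty, while the bound is 1.\<close>
  then show ?thesis by simp
next
  case False
  note G = simple_graphD[OF assms(1)]
  obtain M where M: "is_matching E M" "card M = n" using assms(3) by blast
  obtain h :: "'v \<Rightarrow> nat" where h: "inj_on h V"
    using finite_imp_inj_to_nat_seg[OF G(1)] by blast
  define W where "W = \<Union>M"
  \<comment> \<open>The induced subgraph keeps \<open>V\<close> as its vertex set, with isolated
    vertices outside \<open>W\<close>, so that the same order and the same rank space serve both
    graphs.\<close>
  define F where "F u v \<longleftrightarrow> E u v \<and> u \<in> W \<and> v \<in> W" for u v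
  define f where "f x = snd (avail_run E (lex_choice h x) W \<sigma>)" for x
  define e where "e = (\<integral>x. real (f x) \<partial>rank_space V)"
  have WV: "W \<subseteq> V" using is_matching_subset_Pow[OF assms(1) M(1)] by (auto simp: W_def)
  have finM: "finite M" using M False by (metis card.infinite)
  have finW: "finite W" using WV G(1) by (rule finite_subset)
  have EV: "\<forall>u v. E u v \<longrightarrow> v \<in> V \<and> u \<noteq> v" using G by metis
  have dist: "distinct \<sigma>" using assms(2) by (simp add: valid_order_def)
  have fm: "(\<lambda>x. real (f x)) \<in> borel_measurable (rank_space V)"
    unfolding f_def by (rule measurable_avail_run_lex_choice[OF G(1) WV])

  have SF: "simple_graph V F" using assms(1) unfolding simple_graph_def F_def by blast
  have VF: "valid_order V F \<sigma>"
    by (rule valid_order_subgraph[OF assms(2)]) (simp add: F_def)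
  have MF: "is_matching F M"
    unfolding is_matching_def
  proof (intro conjI ballI impI)
    fix a assume a: "a \<in> M"
    then obtain u v where uv: "a = {u, v}" "E u v" using M(1) unfolding is_matching_def by metis
    then have "F u v" using a by (auto simp: F_def W_def)
    then show "\<exists>u v. a = {u, v} \<and> F u v" using uv(1) by blast
  next
    fix a b assume "a \<in> M" "b \<in> M" "a \<noteq> b"
    then show "a \<inter> b = {}" using M(1) unfolding is_matching_def by metis
  qed
  have AF: "AE x in rank_space V. card (ranking_matching F \<sigma> x) = f x"
    using AE_card_ranking_matching_eq_avail_run[OF assms(1,2) WV] unfolding F_def[abs_def] f_def .
  have "expected_ranking_size V F \<sigma> = e"
    unfolding expected_ranking_size_def e_def
    using AF by (intro integral_cong_AE measurable_card_ranking_matching[OF SF] fm) auto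
  \<comment> \<open>The ratio is applied to \<open>F\<close>, in which \<open>M\<close> is still a
    matching, because the mean that is needed is that of the restricted run.\<close>
  then have e: "ranking_ratio * real n \<le> e"
    using ranking_ratio_le_expected_ranking_size[OF SF VF MF] M by simp

  have "W \<noteq> {}"
  proof
    assume "W = {}"
    then have "M = {}" using M(1) unfolding W_def is_matching_def by fastforce
    then show False using M False by simp
  qed
  then have cW: "card W > 0" "card W \<le> 2 * n"
    using finW card_Union_matching_le[OF M(1) finM] M by (auto simp: W_def card_gt_0_iff)
  let ?d = "\<lambda>i. if i \<in> W then 1 else 0 :: real"
  have d: "(\<Sum>i\<in>V. (?d i)\<^sup>2) = real (card W)"
  proof -
    have "(\<Sum>i\<in>V. (?d i)\<^sup>2) = (\<Sum>i\<in>V. if i \<in> W then 1 else 0)" by (intro sum.cong) auto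
    also have "\<dots> = real (card W)" using G(1) WV by (simp add: sum.If_cases Int_absorb1)
    finally show ?thesis .
  qed
  interpret product_prob_space "\<lambda>_::'v. uniform_measure lborel {0..1::real}" V
    by (intro product_prob_spaceI prob_space_uniform_unit)
  have tail: "measure (rank_space V) {x \<in> space (rank_space V). real (f x) \<le> e - s} \<le> exp (- (1 / real n) * s\<^sup>2)"
    if s: "s > 0" for s
  proof -
    have "measure (rank_space V) {x \<in> space (rank_space V). real (f x) \<le> e - s} \<le> exp (- 2 * s\<^sup>2 / real (card W))"
      unfolding e_def rank_space_def d[symmetric]
    proof (rule McDiarmid_inequality_le[OF G(1) _ _ _ _ s])
      show "\<bar>real (f x)\<bar> \<le> real (card W)" for x
        unfolding f_def using avail_run_le_card[OF consistent_choice_lex_choice[OF G(1) h] EV dist finW] by simp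
      show "\<bar>real (f x) - real (f (x(i := y)))\<bar> \<le> ?d i" for x i y
        unfolding f_def by (rule avail_run_bounded_difference[OF G(1) h WV EV dist])
    qed (use fm cW d in \<open>auto simp: rank_space_def\<close>)
    \<comment> \<open>From \<open>card W \<le> 2 * n\<close>; McDiarmid's factor 2 cancels against
      the two end points of each edge.\<close>
    also have "\<dots> \<le> exp (- (1 / real n) * s\<^sup>2)"
      using cW s False by (simp add: field_simps)
    finally show ?thesis .
  qed

  define A where "A = {x \<in> space (rank_space V). real (card (ranking_matching E \<sigma> x)) < (ranking_ratio - \<alpha>) * real n}"
  define B where "B = {x \<in> space (rank_space V). real (f x) < e - \<alpha> * real n}"
  have B: "B \<in> sets (rank_space V)" unfolding B_def using fm by measurable
  \<comment> \<open>Two comparisons combine: the full run matches at least \<open>f x\<close> pairs,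
    and the threshold \<open>(ranking_ratio - \<alpha>) * real n\<close> is at most
    \<open>e - \<alpha> * real n\<close>.\<close>
  have "AE x in rank_space V. x \<in> A \<longrightarrow> x \<in> B"
    using AE_card_ranking_matching_eq_avail_run[OF assms(1,2) order_refl, of h]
  proof (rule eventually_mono)
    fix x assume "card (ranking_matching (\<lambda>u v. E u v \<and> u \<in> V \<and> v \<in> V) \<sigma> x)
      = snd (avail_run E (lex_choice h x) V \<sigma>)"
    moreover have "(\<lambda>u v. E u v \<and> u \<in> V \<and> v \<in> V) = E" using G by (auto simp: fun_eq_iff)
    ultimately have "f x \<le> card (ranking_matching E \<sigma> x)"
      unfolding f_def using avail_run_mono[OF consistent_choice_lex_choice[OF G(1) h] EV dist WV G(1)] by simp
    then show "x \<in> A \<longrightarrow> x \<in> B" using e by (auto simp: A_def B_def algebra_simps)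
  qed
  then have "measure (rank_space V) A \<le> measure (rank_space V) B"
    using B prob_space_rank_space[of V] by (intro finite_measure.finite_measure_mono_AE prob_space.finite_measure)
  also have "\<dots> < exp (- (1 / real n) * (\<alpha> * real n)\<^sup>2)"
    unfolding B_def using False assms(4) tail by (intro nat_valued_lower_tail_strict) auto
  also have "- (1 / real n) * (\<alpha> * real n)\<^sup>2 = - (\<alpha>\<^sup>2) * real n"
    using False by (simp add: power2_eq_square field_simps)
  finally show ?thesis unfolding A_def .
qed

end
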